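(* Let $C=\{(x,y)\in\mathbb{R}^2 \mid a_{11}x^2+a_{22}y^2+2a_{12}xy+2a_1x+2a_2y+c=0\}$ (real coefficients) be an irreducible quadratic curve. Then the anti-pedal $\mathrm{APe}_C$ of $C$ is an irreducible quadratic curve. Moreover: (1) If the origin is an isolated point of the pedal $\mathrm{Pe}_C$, then $\mathrm{APe}_C$ is an ellipse. (2) The anti-pedal $\mathrm{APe}_C$ is a parabola if and only if $(0,0)\in C$.
   Context: A quadratic curve with equation $a_{11}x^2+a_{22}y^2+2a_{12}xy+2a_1x+2a_2y+c=0$ is irreducible if it is not a union of two (possibly equal) lines, equivalently $$\Delta=\det\begin{pmatrix} a_{11} & a_{12} & a_1 \\ a_{12} & a_{22} & a_2 \\ a_1 & a_2 & c \end{pmatrix}\neq0 .$$ Here $C$ is a non-empty real curve, hence an ellipse, hyperbola or parabola. The pedal of $C$ with respect to the origin (the locus of feet of perpendiculars from the origin to the tangent lines of $C$) is understood as the algebraic curve $\mathrm{Pe}_C=\{(x,y)\in\mathbb{R}^2\mid G_1[C](x,y)=0\}$, where $$G_1[C](x,y)=(a_{12}^2-a_{11}a_{22})(x^2+y^2)^2+2(a_{12}a_2-a_1a_{22})(x^2+y^2)x+2(a_1a_{12}-a_2a_{11})(x^2+y^2)y+(a_2^2-a_{22}c)x^2+2(a_{12}c-a_1a_2)xy+(a_1^2-a_{11}c)y^2,$$ which always contains the origin (possibly as an isolated point). The anti-pedal of $C$ (the inversion of the pedal under $\boldsymbol{x}\mapsto\boldsymbol{x}/\|\boldsymbol{x}\|^2$,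 extended to all of $\mathbb{R}^2$) is $\mathrm{APe}_C=\{(x,y)\in\mathbb{R}^2\mid G_2[C](x,y)=0\}$, where $$G_2[C](x,y)=(a_2^2-a_{22}c)x^2+(a_1^2-a_{11}c)y^2+2(a_{12}c-a_1a_2)xy+2(a_{12}a_2-a_1a_{22})x+2(a_1a_{12}-a_{11}a_2)y+a_{12}^2-a_{11}a_{22}.$$ *)

theory Defs
  imports "HOL-Analysis.Analysis"
begin

definition quad :: "'a::comm_ring_1 \<Rightarrow> 'a \<Rightarrow> 'a \<Rightarrow> 'a \<Rightarrow> 'a \<Rightarrow> 'a \<Rightarrow> 'a \<Rightarrow> 'a \<Rightarrow> 'a" where
  "quad a11 a22 a12 a1 a2 c x y =
     a11 * x\<^sup>2 + a22 * y\<^sup>2 + 2 * a12 * x * y + 2 * a1 * x + 2 * a2 * y + c"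

definition quad_locus :: "'a::comm_ring_1 \<Rightarrow> 'a \<Rightarrow> 'a \<Rightarrow> 'a \<Rightarrow> 'a \<Rightarrow> 'a \<Rightarrow> ('a \<times> 'a) set" where
  "quad_locus a11 a22 a12 a1 a2 c = {(x, y). quad a11 a22 a12 a1 a2 c x y = 0}"

definition is_line :: "('a::field \<times> 'a) set \<Rightarrow> bool" where
  "is_line L \<longleftrightarrow> (\<exists>p q r. (p, q) \<noteq> (0, 0) \<and> L = {(x, y). p * x + q * y + r = 0})"

text \<open>
  Lines are taken in the complex plane: over the reals, \<open>x\<^sup>2 + y\<^sup>2 = 0\<close> would not be a
  union of lines although its determinant vanishes. With complex lines, irreducibility is
  equivalent to the non-vanishing of the determinant, see \<open>irreducible_quad_iff_det\<close> below.
\<close>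

definition irreducible_quad :: "real \<Rightarrow> real \<Rightarrow> real \<Rightarrow> real \<Rightarrow> real \<Rightarrow> real \<Rightarrow> bool" where
  "irreducible_quad a11 a22 a12 a1 a2 c \<longleftrightarrow>
     (a11, a22, a12) \<noteq> (0, 0, 0) \<and>
     \<not> (\<exists>L1 L2 :: (complex \<times> complex) set. is_line L1 \<and> is_line L2 \<and>
          quad_locus (of_real a11) (of_real a22) (of_real a12)
            (of_real a1) (of_real a2) (of_real c) = L1 \<union> L2)"

text \<open>A curve is a subset of the real plane; non-emptiness rules out imaginary ellipses.\<close>

definition irreducible_quadratic_curve :: "(real \<times> real) set \<Rightarrow> bool" where
  "irreducible_quadratic_curve S \<longleftrightarrow> S \<noteq> {} \<and>
     (\<exists>a11 a22 a12 a1 a2 c. irreducible_quad a11 a22 a12 a1 a2 c \<and>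
        S = quad_locus a11 a22 a12 a1 a2 c)"

text \<open>
  The pedal is the full zero set of its polynomial, so it always contains the origin, even when
  the origin is not the foot of a perpendicular to a tangent line. The polynomial of the
  anti-pedal arises from it by substituting \<open>p / \<parallel>p\<parallel>\<^sup>2\<close> for \<open>p\<close> and multiplying by \<open>\<parallel>p\<parallel>\<^sup>4\<close>;
  it is imposed at the origin as well.
\<close>

definition pedal :: "real \<Rightarrow> real \<Rightarrow> real \<Rightarrow> real \<Rightarrow> real \<Rightarrow> real \<Rightarrow> (real \<times> real) set" where
  "pedal a11 a22 a12 a1 a2 c = {(x, y).
     (a12\<^sup>2 - a11 * a22) * (x\<^sup>2 + y\<^sup>2)\<^sup>2
     + 2 * (a12 * a2 - a1 * a22) * (x\<^sup>2 + y\<^sup>2) * x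
     + 2 * (a1 * a12 - a2 * a11) * (x\<^sup>2 + y\<^sup>2) * y
     + (a2\<^sup>2 - a22 * c) * x\<^sup>2
     + 2 * (a12 * c - a1 * a2) * x * y
     + (a1\<^sup>2 - a11 * c) * y\<^sup>2 = 0}"

definition antipedal :: "real \<Rightarrow> real \<Rightarrow> real \<Rightarrow> real \<Rightarrow> real \<Rightarrow> real \<Rightarrow> (real \<times> real) set" where
  "antipedal a11 a22 a12 a1 a2 c = {(x, y).
     (a2\<^sup>2 - a22 * c) * x\<^sup>2 + (a1\<^sup>2 - a11 * c) * y\<^sup>2
     + 2 * (a12 * c - a1 * a2) * x * y
     + 2 * (a12 * a2 - a1 * a22) * x
     + 2 * (a1 * a12 - a11 * a2) * y
     + a12\<^sup>2 - a11 * a22 = 0}"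

text \<open>
  Ellipses and parabolas are given by their canonical equations in some orthonormal frame
  \<open>u, v\<close> with origin \<open>m\<close>. Circles count as ellipses.
\<close>

definition orthonormal_frame :: "real \<times> real \<Rightarrow> real \<times> real \<Rightarrow> bool" where
  "orthonormal_frame u v \<longleftrightarrow> norm u = 1 \<and> norm v = 1 \<and> u \<bullet> v = 0"

definition is_ellipse :: "(real \<times> real) set \<Rightarrow> bool" where
  "is_ellipse S \<longleftrightarrow> (\<exists>m u v a b. orthonormal_frame u v \<and> a > 0 \<and> b > 0 \<and>
     S = {m + s *\<^sub>R u + t *\<^sub>R v | s t. s\<^sup>2 / a\<^sup>2 + t\<^sup>2 / b\<^sup>2 = 1})"

definition is_parabola :: "(real \<times> real) set \<Rightarrow> bool" where
  "is_parabola S \<longleftrightarrow> (\<exists>m u v k. orthonormal_frame u v \<and> k > 0 \<and>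
     S = {m + s *\<^sub>R u + t *\<^sub>R v | s t. t = k * s\<^sup>2})"

lemma quad_contains_line_det:
  fixes a11 a22 a12 a1 a2 c :: "'a::field_char_0"
  assumes L: "is_line L" and sub: "L \<subseteq> quad_locus a11 a22 a12 a1 a2 c"
  shows "a11 * a22 * c + 2 * a12 * a1 * a2 - a11 * a2\<^sup>2 - a22 * a1\<^sup>2 - c * a12\<^sup>2 = 0"
proof -
  from L obtain p q r where pq: "(p, q) \<noteq> (0, 0)" and Leq: "L = {(x, y). p * x + q * y + r = 0}"
    unfolding is_line_def by blast
  have z: "quad a11 a22 a12 a1 a2 c x y = 0" if "p * x + q * y + r = 0" for x y
    using sub that unfolding Leq quad_locus_def by blast
  show ?thesis
  proof (cases "q = 0")
    case False
    define m n where "m = - p / q" and "n = - r / q"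
    have "p * x + q * (m * x + n) + r = 0" for x
      using False by (simp add: m_def n_def field_simps)
    then have e: "quad a11 a22 a12 a1 a2 c x (m * x + n) = 0" for x
      using z by blast
    have e0: "a22 * n\<^sup>2 + 2 * a2 * n + c = 0"
      using e[of 0] by (simp add: quad_def)
    have e1: "a11 + a22 * (m + n)\<^sup>2 + 2 * a12 * (m + n) + 2 * a1 + 2 * a2 * (m + n) + c = 0"
      using e[of 1] by (simp add: quad_def)
    have e2: "a11 + a22 * (n - m)\<^sup>2 - 2 * a12 * (n - m) - 2 * a1 + 2 * a2 * (n - m) + c = 0"
      using e[of "-1"] by (simp add: quad_def algebra_simps)
    have "2 * (a11 + a22 * m\<^sup>2 + 2 * a12 * m) = 0"
      using e0 e1 e2 by algebra
    then have "a11 + a22 * m\<^sup>2 + 2 * a12 * m = 0"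
      by (metis mult_eq_0_iff zero_neq_numeral)
    then have f1: "a11 = - a22 * m\<^sup>2 - 2 * a12 * m" by algebra
    have "4 * (a22 * m * n + a12 * n + a1 + a2 * m) = 0"
      using e1 e2 by algebra
    then have "a22 * m * n + a12 * n + a1 + a2 * m = 0"
      by (metis mult_eq_0_iff zero_neq_numeral)
    then have f2: "a1 = - a22 * m * n - a12 * n - a2 * m" by algebra
    have f3: "c = - a22 * n\<^sup>2 - 2 * a2 * n" using e0 by algebra
    show ?thesis unfolding f1 f2 f3 by algebra
  next
    case True
    then have p: "p \<noteq> 0" using pq by simp
    define n where "n = - r / p"
    have "p * n + q * y + r = 0" for y
      using True p by (simp add: n_def)
    then have e: "quad a11 a22 a12 a1 a2 c n y = 0" for y
      using z by blast
    have e0: "a11 * n\<^sup>2 + 2 * a1 * n + c = 0"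
      using e[of 0] by (simp add: quad_def)
    have e1: "a11 * n\<^sup>2 + a22 + 2 * a12 * n + 2 * a1 * n + 2 * a2 + c = 0"
      using e[of 1] by (simp add: quad_def)
    have e2: "a11 * n\<^sup>2 + a22 - 2 * a12 * n + 2 * a1 * n - 2 * a2 + c = 0"
      using e[of "-1"] by (simp add: quad_def algebra_simps)
    have "2 * a22 = 0" using e0 e1 e2 by algebra
    then have f1: "a22 = 0" by simp
    have "4 * (a12 * n + a2) = 0" using e1 e2 by algebra
    then have "a12 * n + a2 = 0"
      by (metis mult_eq_0_iff zero_neq_numeral)
    then have f2: "a2 = - a12 * n" by algebra
    have f3: "c = - a11 * n\<^sup>2 - 2 * a1 * n" using e0 by algebra
    show ?thesis unfolding f1 f2 f3 by algebra
  qed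
qed

lemma quad_factor:
  fixes a11 a22 a12 a1 a2 c :: complex
  assumes nz: "a11 \<noteq> 0"
    and det: "a11 * a22 * c + 2 * a12 * a1 * a2 - a11 * a2\<^sup>2 - a22 * a1\<^sup>2 - c * a12\<^sup>2 = 0"
  shows "\<exists>L1 L2. is_line L1 \<and> is_line L2 \<and> quad_locus a11 a22 a12 a1 a2 c = L1 \<union> L2"
proof -
  define P R S where "P = a12\<^sup>2 - a11 * a22" and "R = a12 * a1 - a11 * a2"
    and "S = a1\<^sup>2 - a11 * c"
  have RPS: "R\<^sup>2 = P * S" unfolding P_def R_def S_def using det by algebra
  obtain s t where s: "s\<^sup>2 = P" and st: "s * t = R" and t: "t\<^sup>2 = S"
  proof (cases "P = 0")
    case True
    then have "R = 0" using RPS by simp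
    then show ?thesis using that[of 0 "csqrt S"] True by simp
  next
    case False
    then have "csqrt P \<noteq> 0" by simp
    moreover have "(R / csqrt P)\<^sup>2 = S"
      using False RPS by (simp add: power_divide)
    ultimately show ?thesis using that[of "csqrt P" "R / csqrt P"] by simp
  qed
  have fac: "a11 * quad a11 a22 a12 a1 a2 c x y =
      (a11 * x + (a12 + s) * y + (a1 + t)) * (a11 * x + (a12 - s) * y + (a1 - t))" for x y
    using s st t unfolding quad_def P_def R_def S_def by algebra
  have "quad_locus a11 a22 a12 a1 a2 c =
      {(x, y). a11 * x + (a12 + s) * y + (a1 + t) = 0} \<union>
      {(x, y). a11 * x + (a12 - s) * y + (a1 - t) = 0}"
    unfolding quad_locus_def using fac nz by (auto, metis mult_eq_0_iff)+
  moreover have "is_line {(x, y). a11 * x + (a12 + s) * y + (a1 + t) = 0}"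
    "is_line {(x, y). a11 * x + (a12 - s) * y + (a1 - t) = 0}"
    unfolding is_line_def using nz by blast+
  ultimately show ?thesis by blast
qed

lemma quad_locus_swap:
  "quad_locus a11 a22 a12 a1 a2 c = prod.swap ` quad_locus a22 a11 a12 a2 a1 c"
  by (force simp: quad_locus_def quad_def algebra_simps image_iff)

lemma is_line_swap: "is_line L \<Longrightarrow> is_line (prod.swap ` L)"
proof -
  assume "is_line L"
  then obtain p q r where "(p, q) \<noteq> (0, 0)" "L = {(x, y). p * x + q * y + r = 0}"
    unfolding is_line_def by blast
  then have "(q, p) \<noteq> (0, 0)" "prod.swap ` L = {(x, y). q * x + p * y + r = 0}"
    by (auto simp: image_iff algebra_simps)
  then show ?thesis unfolding is_line_def by blast
qed

lemma quad_reducible: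
  fixes a11 a22 a12 a1 a2 c :: complex
  assumes nz: "(a11, a22, a12) \<noteq> (0, 0, 0)"
    and det: "a11 * a22 * c + 2 * a12 * a1 * a2 - a11 * a2\<^sup>2 - a22 * a1\<^sup>2 - c * a12\<^sup>2 = 0"
  shows "\<exists>L1 L2. is_line L1 \<and> is_line L2 \<and> quad_locus a11 a22 a12 a1 a2 c = L1 \<union> L2"
proof -
  consider "a11 \<noteq> 0" | "a22 \<noteq> 0" | "a11 = 0" "a22 = 0" "a12 \<noteq> 0"
    using nz by auto
  then show ?thesis
  proof cases
    case 1
    then show ?thesis using quad_factor det by blast
  next
    case 2
    have "a22 * a11 * c + 2 * a12 * a2 * a1 - a22 * a1\<^sup>2 - a11 * a2\<^sup>2 - c * a12\<^sup>2 = 0"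
      using det by algebra
    from quad_factor[OF 2 this] obtain L1 L2 where
      "is_line L1" "is_line L2" "quad_locus a22 a11 a12 a2 a1 c = L1 \<union> L2" by blast
    then show ?thesis
      using quad_locus_swap[of a11 a22 a12 a1 a2 c] is_line_swap by (metis image_Un)
  next
    case 3
    have "a12 * (2 * a1 * a2 - c * a12) = 0" using det 3 by algebra
    then have c: "c * a12 = 2 * a1 * a2" using 3 by simp
    have fac: "a12 * quad a11 a22 a12 a1 a2 c x y =
        2 * ((a12 * x + 0 * y + a2) * (0 * x + a12 * y + a1))" for x y
      using c unfolding quad_def 3(1,2) by algebra
    have "quad a11 a22 a12 a1 a2 c x y = 0 \<longleftrightarrow>
        a12 * x + 0 * y + a2 = 0 \<or> 0 * x + a12 * y + a1 = 0" for x y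
      using fac[of x y] 3(3) by (metis mult_eq_0_iff zero_neq_numeral)
    then have "quad_locus a11 a22 a12 a1 a2 c =
        {(x, y). a12 * x + 0 * y + a2 = 0} \<union> {(x, y). 0 * x + a12 * y + a1 = 0}"
      unfolding quad_locus_def by blast
    moreover have "is_line {(x, y). a12 * x + 0 * y + a2 = 0}"
      "is_line {(x, y). 0 * x + a12 * y + a1 = 0}"
      unfolding is_line_def using 3(3) by blast+
    ultimately show ?thesis by blast
  qed
qed

theorem irreducible_quad_iff_det:
  "irreducible_quad a11 a22 a12 a1 a2 c \<longleftrightarrow>
     det (vector [vector [a11, a12, a1], vector [a12, a22, a2], vector [a1, a2, c]] :: real^3^3) \<noteq> 0"
proof -
  let ?D = "a11 * a22 * c + 2 * a12 * a1 * a2 - a11 * a2\<^sup>2 - a22 * a1\<^sup>2 - c * a12\<^sup>2"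
  have D: "det (vector [vector [a11, a12, a1], vector [a12, a22, a2], vector [a1, a2, c]] :: real^3^3) = ?D"
    by (simp add: det_3 vector_3 power2_eq_square algebra_simps)
  have C: "complex_of_real a11 * of_real a22 * of_real c + 2 * of_real a12 * of_real a1 * of_real a2
      - of_real a11 * (of_real a2)\<^sup>2 - of_real a22 * (of_real a1)\<^sup>2 - of_real c * (of_real a12)\<^sup>2
      = of_real ?D"
    by simp
  show ?thesis
  proof
    assume irr: "irreducible_quad a11 a22 a12 a1 a2 c"
    have "?D \<noteq> 0"
    proof
      assume "?D = 0"
      then have "complex_of_real ?D = 0" by (simp only: of_real_0)
      moreover have "(complex_of_real a11, complex_of_real a22, complex_of_real a12) \<noteq> (0, 0, 0)"
        using irr by (auto simp: irreducible_quad_def)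
      ultimately show False
        using quad_reducible C irr unfolding irreducible_quad_def by metis
    qed
    then show "det (vector [vector [a11, a12, a1], vector [a12, a22, a2], vector [a1, a2, c]] :: real^3^3) \<noteq> 0"
      unfolding D .
  next
    assume "det (vector [vector [a11, a12, a1], vector [a12, a22, a2], vector [a1, a2, c]] :: real^3^3) \<noteq> 0"
    then have nz: "?D \<noteq> 0" unfolding D .
    then have "complex_of_real ?D \<noteq> 0" by (simp only: of_real_eq_0_iff not_False_eq_True)
    then have "\<not> (is_line L1 \<and> quad_locus (complex_of_real a11) (of_real a22) (of_real a12)
        (of_real a1) (of_real a2) (of_real c) = L1 \<union> L2)" for L1 L2
      using quad_contains_line_det[of L1 "of_real a11" "of_real a22" "of_real a12"
        "of_real a1" "of_real a2" "of_real c"] C by (metis Un_upper1)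
    moreover have "(a11, a22, a12) \<noteq> (0, 0, 0)" using nz by auto
    ultimately show "irreducible_quad a11 a22 a12 a1 a2 c"
      unfolding irreducible_quad_def by blast
  qed
qed

end

theory Submission
  imports Defs
begin

text \<open>
  Write \<open>A\<close> for the symmetric \<open>3 \<times> 3\<close> matrix of \<open>C\<close> and \<open>\<Delta>\<close> for its determinant. Up to a sign
  and the reflection \<open>p \<mapsto> - p\<close>, the matrix of the anti-pedal is the adjugate of \<open>A\<close>: the
  anti-pedal is the dual conic, the set of tangent lines of \<open>C\<close>. Everything follows from two
  determinants. The one of the whole matrix of the anti-pedal is \<open>-\<Delta>\<^sup>2 \<noteq> 0\<close>, so the anti-pedal is
  irreducible; the one of its quadratic part is \<open>c \<Delta>\<close>, and the sign of \<open>c \<Delta>\<close> decides the type.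

  If \<open>c = 0\<close>, that is, if the origin lies on \<open>C\<close>, the anti-pedal is a parabola, and a parabola
  arises in no other way. If \<open>c \<Delta> < 0\<close>, it is a hyperbola. If \<open>c \<Delta> > 0\<close>, it is an ellipse, real
  or imaginary. An imaginary ellipse would make \<open>A\<close> definite, which is impossible because \<open>C\<close> has
  a real point (\<open>antipedal_leading_coefficient_positive\<close>).

  The inversion \<open>p \<mapsto> p / \<parallel>p\<parallel>\<^sup>2\<close> sends far points of the anti-pedal to points of the pedal near the
  origin. So if the origin is isolated in the pedal, then the anti-pedal is bounded
  (\<open>antipedal_bounded\<close>). A conic with \<open>c \<Delta> \<le> 0\<close> is unbounded (\<open>quad_locus_unbounded\<close>), which
  leaves the ellipse.
\<close>

section \<open>Conics in an orthonormal frame\<close>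

definition quad_det :: "real \<Rightarrow> real \<Rightarrow> real \<Rightarrow> real \<Rightarrow> real \<Rightarrow> real \<Rightarrow> real" where
  "quad_det a11 a22 a12 a1 a2 c =
     a11 * a22 * c + 2 * a12 * a1 * a2 - a11 * a2\<^sup>2 - a22 * a1\<^sup>2 - c * a12\<^sup>2"

lemma irreducible_quad_iff_quad_det:
  "irreducible_quad a11 a22 a12 a1 a2 c \<longleftrightarrow> quad_det a11 a22 a12 a1 a2 c \<noteq> 0"
proof -
  have "det (vector [vector [a11, a12, a1], vector [a12, a22, a2], vector [a1, a2, c]] :: real^3^3)
      = quad_det a11 a22 a12 a1 a2 c"
    by (simp add: det_3 vector_3 quad_det_def power2_eq_square algebra_simps)
  then show ?thesis by (simp add: irreducible_quad_iff_det)
qed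

text \<open>
  This is the spectral theorem for symmetric \<open>2 \<times> 2\<close> matrices. Subtracting half the trace leaves
  a traceless matrix, which is a multiple \<open>r\<close> of a reflection matrix with angle \<open>\<phi>\<close>; its axis has
  the angle \<open>\<phi> / 2\<close>.
\<close>

lemma principal_axes:
  fixes a b h :: real
  obtains p q l m where "p\<^sup>2 + q\<^sup>2 = 1" "a = l * p\<^sup>2 + m * q\<^sup>2" "b = l * q\<^sup>2 + m * p\<^sup>2"
    "h = (l - m) * p * q"
proof -
  obtain r \<phi> where r: "(a - b) / 2 = r * cos \<phi>" "h = r * sin \<phi>"
    using polar_Ex by blast
  define p q where "p = cos (\<phi> / 2)" and "q = sin (\<phi> / 2)"
  have one: "p\<^sup>2 + q\<^sup>2 = 1" by (simp add: p_def q_def)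
  have "cos \<phi> = p\<^sup>2 - q\<^sup>2" "sin \<phi> = 2 * q * p"
    using cos_double[of "\<phi> / 2"] sin_double[of "\<phi> / 2"] by (simp_all add: p_def q_def)
  moreover have "a - b = 2 * (r * cos \<phi>)" using r(1) by simp
  ultimately have d: "a - b = 2 * r * (p\<^sup>2 - q\<^sup>2)" and h: "h = 2 * r * p * q"
    using r(2) by algebra+
  define s where "s = (a + b) / 2"
  have s: "a + b = 2 * s" by (simp add: s_def)
  have "2 * a = 2 * ((s + r) * p\<^sup>2 + (s - r) * q\<^sup>2)" using d s one by algebra
  moreover have "2 * b = 2 * ((s + r) * q\<^sup>2 + (s - r) * p\<^sup>2)" using d s one by algebra
  moreover have "h = ((s + r) - (s - r)) * p * q" using h by algebra
  ultimately show ?thesis using that[of p q "s + r" "s - r"] one by simp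
qed

lemma orthonormal_frame_rotation:
  "p\<^sup>2 + q\<^sup>2 = 1 \<Longrightarrow> orthonormal_frame (p, q) (- q, p)"
  by (simp add: orthonormal_frame_def norm_Pair inner_Pair add.commute)

lemma quad_locus_in_frame:
  fixes p q :: real
  assumes pq: "p\<^sup>2 + q\<^sup>2 = 1"
    and F: "\<And>s t. quad a11 a22 a12 a1 a2 c (m1 + s * p - t * q) (m2 + s * q + t * p) = F s t"
  shows "quad_locus a11 a22 a12 a1 a2 c =
    {(m1, m2) + s *\<^sub>R (p, q) + t *\<^sub>R (- q, p) | s t. F s t = 0}"
proof (intro set_eqI iffI)
  fix z assume z: "z \<in> quad_locus a11 a22 a12 a1 a2 c"
  obtain x y where xy: "z = (x, y)" by (cases z)
  \<comment> \<open>The frame coordinates of a point are the inner products with the frame vectors.\<close>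
  define s t where "s = (x - m1) * p + (y - m2) * q" and "t = (y - m2) * p - (x - m1) * q"
  have x: "x = m1 + s * p - t * q" and y: "y = m2 + s * q + t * p"
    unfolding s_def t_def using pq by algebra+
  have "F s t = 0" using z F[of s t] xy x y by (auto simp: quad_locus_def)
  moreover have "z = (m1, m2) + s *\<^sub>R (p, q) + t *\<^sub>R (- q, p)" using xy x y by simp
  ultimately show "z \<in> {(m1, m2) + s *\<^sub>R (p, q) + t *\<^sub>R (- q, p) | s t. F s t = 0}" by blast
next
  fix z assume "z \<in> {(m1, m2) + s *\<^sub>R (p, q) + t *\<^sub>R (- q, p) | s t. F s t = 0}"
  then obtain s t where z: "z = (m1, m2) + s *\<^sub>R (p, q) + t *\<^sub>R (- q, p)" and "F s t = 0" by blast
  then show "z \<in> quad_locus a11 a22 a12 a1 a2 c" using F[of s t] by (simp add: quad_locus_def)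
qed

text \<open>
  If the quadratic part is nondegenerate, then the gradient vanishes at exactly one point, the
  centre. Moving the origin there kills the linear part, and the principal axes kill the mixed
  term.
\<close>

lemma central_normal_form:
  fixes a11 a22 a12 a1 a2 c :: real
  assumes nz: "a11 * a22 - a12\<^sup>2 \<noteq> 0"
  obtains m u v l n k where "orthonormal_frame u v"
    "l * n = a11 * a22 - a12\<^sup>2" "l + n = a11 + a22" "l * n * k = quad_det a11 a22 a12 a1 a2 c"
    "quad_locus a11 a22 a12 a1 a2 c = {m + s *\<^sub>R u + t *\<^sub>R v | s t. l * s\<^sup>2 + n * t\<^sup>2 + k = 0}"
proof -
  obtain p q l n where pq: "p\<^sup>2 + q\<^sup>2 = 1" and a: "a11 = l * p\<^sup>2 + n * q\<^sup>2"
    "a22 = l * q\<^sup>2 + n * p\<^sup>2" "a12 = (l - n) * p * q"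
    by (rule principal_axes)
  define d where "d = a11 * a22 - a12\<^sup>2"
  have d: "d \<noteq> 0" using nz by (simp add: d_def)
  have ln: "l * n = d" unfolding d_def a using pq by algebra
  have tr: "l + n = a11 + a22" unfolding a using pq by algebra
  define m1 m2 where "m1 = (a12 * a2 - a22 * a1) / d" and "m2 = (a12 * a1 - a11 * a2) / d"
  have "d * m1 = a12 * a2 - a22 * a1" "d * m2 = a12 * a1 - a11 * a2"
    using d by (simp_all add: m1_def m2_def)
  then have "d * (a11 * m1 + a12 * m2 + a1) = 0" "d * (a12 * m1 + a22 * m2 + a2) = 0"
    unfolding d_def by algebra+
  then have g: "a11 * m1 + a12 * m2 + a1 = 0" "a12 * m1 + a22 * m2 + a2 = 0"
    using d by simp_all
  define k where "k = quad a11 a22 a12 a1 a2 c m1 m2"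
  have shift: "quad a11 a22 a12 a1 a2 c (m1 + x) (m2 + y) =
      a11 * x\<^sup>2 + a22 * y\<^sup>2 + 2 * a12 * x * y + k" for x y
    using g unfolding k_def quad_def by algebra
  have diag: "a11 * (s * p - t * q)\<^sup>2 + a22 * (s * q + t * p)\<^sup>2
      + 2 * a12 * (s * p - t * q) * (s * q + t * p) = l * s\<^sup>2 + n * t\<^sup>2" for s t
    unfolding a using pq by algebra
  have "quad a11 a22 a12 a1 a2 c (m1 + s * p - t * q) (m2 + s * q + t * p)
      = l * s\<^sup>2 + n * t\<^sup>2 + k" for s t
    using shift[of "s * p - t * q" "s * q + t * p"] diag[of s t] by (simp add: algebra_simps)
  then have S: "quad_locus a11 a22 a12 a1 a2 c =
      {(m1, m2) + s *\<^sub>R (p, q) + t *\<^sub>R (- q, p) | s t. l * s\<^sup>2 + n * t\<^sup>2 + k = 0}"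
    by (rule quad_locus_in_frame[OF pq])
  have "d * k = quad_det a11 a22 a12 a1 a2 c"
    unfolding d_def k_def quad_def quad_det_def using g by algebra
  then show ?thesis
    using that[OF orthonormal_frame_rotation[OF pq] _ tr _ S] ln d_def by simp
qed

section \<open>The type of a conic\<close>

lemma is_ellipse_if_pos:
  assumes d: "a11 * a22 - a12\<^sup>2 > 0" and D: "quad_det a11 a22 a12 a1 a2 c \<noteq> 0"
    and ne: "quad_locus a11 a22 a12 a1 a2 c \<noteq> {}"
  shows "is_ellipse (quad_locus a11 a22 a12 a1 a2 c)"
proof -
  have nz: "a11 * a22 - a12\<^sup>2 \<noteq> 0" using d by simp
  obtain m u v l n k where f: "orthonormal_frame u v"
    and ln: "l * n = a11 * a22 - a12\<^sup>2" and "l + n = a11 + a22"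
    and lnk: "l * n * k = quad_det a11 a22 a12 a1 a2 c"
    and S: "quad_locus a11 a22 a12 a1 a2 c =
      {m + s *\<^sub>R u + t *\<^sub>R v | s t. l * s\<^sup>2 + n * t\<^sup>2 + k = 0}"
    by (rule central_normal_form[OF nz])
  have pos: "l * n > 0" using ln d by simp
  have k: "k \<noteq> 0" using lnk D by auto
  obtain s0 t0 where e: "l * s0\<^sup>2 + n * t0\<^sup>2 + k = 0" using ne S by blast
  have lk: "- k / l > 0 \<and> - k / n > 0"
  proof (cases "l > 0")
    case True
    then have n: "n > 0" using pos by (simp add: zero_less_mult_iff)
    then have "l * s0\<^sup>2 + n * t0\<^sup>2 \<ge> 0" using True by simp
    then have "k < 0" using e k by linarith
    then show ?thesis using True n by (simp add: divide_less_0_iff)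
  next
    case False
    then have l: "l < 0" and n: "n < 0" using pos by (auto simp: zero_less_mult_iff)
    then have "l * s0\<^sup>2 \<le> 0" "n * t0\<^sup>2 \<le> 0" by (auto simp: mult_nonpos_nonneg)
    then have "k > 0" using e k by linarith
    then show ?thesis using l n by (simp add: divide_less_0_iff)
  qed
  define a b where "a = sqrt (- k / l)" and "b = sqrt (- k / n)"
  have ab: "a > 0" "b > 0" "a\<^sup>2 = - k / l" "b\<^sup>2 = - k / n"
    using lk by (simp_all add: a_def b_def)
  have eq: "l * s\<^sup>2 + n * t\<^sup>2 + k = 0 \<longleftrightarrow> s\<^sup>2 / a\<^sup>2 + t\<^sup>2 / b\<^sup>2 = 1" for s t
  proof -
    have "l \<noteq> 0" "n \<noteq> 0" using pos by auto
    then have "s\<^sup>2 / a\<^sup>2 + t\<^sup>2 / b\<^sup>2 = - (l * s\<^sup>2 + n * t\<^sup>2) / k"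
      unfolding ab(3,4) using k by (simp add: field_simps)
    also have "\<dots> = 1 \<longleftrightarrow> - (l * s\<^sup>2 + n * t\<^sup>2) = k"
      using k by (simp only: divide_eq_1_iff) simp
    finally show ?thesis by linarith
  qed
  show ?thesis unfolding is_ellipse_def S eq using f ab(1,2) by blast
qed

text \<open>
  When the quadratic part is singular, it is \<open>\<lambda> s\<^sup>2\<close> in its principal axes, and the determinant is
  \<open>-\<lambda> \<beta>\<^sup>2\<close> with \<open>2 \<beta>\<close> the coefficient of \<open>t\<close>. So \<open>\<beta> \<noteq> 0\<close>, and completing the square in \<open>s\<close>
  absorbs the remaining terms into a translation.
\<close>

lemma is_parabola_if_zero:
  fixes a11 a22 a12 a1 a2 c :: real
  assumes d: "a11 * a22 - a12\<^sup>2 = 0" and D: "quad_det a11 a22 a12 a1 a2 c \<noteq> 0"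
  shows "is_parabola (quad_locus a11 a22 a12 a1 a2 c)"
proof -
  obtain p q l where pq: "p\<^sup>2 + q\<^sup>2 = 1"
    and a: "a11 = l * p\<^sup>2" "a22 = l * q\<^sup>2" "a12 = l * p * q"
  proof -
    obtain p q l n where pq: "p\<^sup>2 + q\<^sup>2 = 1" and a: "a11 = l * p\<^sup>2 + n * q\<^sup>2"
      "a22 = l * q\<^sup>2 + n * p\<^sup>2" "a12 = (l - n) * p * q"
      by (rule principal_axes)
    have "l * n = a11 * a22 - a12\<^sup>2" unfolding a using pq by algebra
    then consider "n = 0" | "l = 0" using d by auto
    then show ?thesis
    proof cases
      case 1
      then show ?thesis using that[OF pq, of l] a by simp
    next
      case 2
      have "(- q)\<^sup>2 + p\<^sup>2 = 1" using pq by simp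
      then show ?thesis using that[of "- q" p n] a 2 by simp
    qed
  qed
  define \<alpha> \<beta> where "\<alpha> = a1 * p + a2 * q" and "\<beta> = a2 * p - a1 * q"
  have "quad_det a11 a22 a12 a1 a2 c = - l * \<beta>\<^sup>2"
    unfolding quad_det_def a \<beta>_def by algebra
  then have l: "l \<noteq> 0" and \<beta>: "\<beta> \<noteq> 0" using D by auto
  \<comment> \<open>The vertex in frame coordinates.\<close>
  define s0 t0 where "s0 = - \<alpha> / l" and "t0 = (\<alpha>\<^sup>2 / l - c) / (2 * \<beta>)"
  have s0: "l * s0 = - \<alpha>" using l by (simp add: s0_def)
  have t0: "2 * l * \<beta> * t0 = \<alpha>\<^sup>2 - l * c" using l \<beta> by (simp add: t0_def field_simps)
  define m1 m2 where "m1 = s0 * p - t0 * q" and "m2 = s0 * q + t0 * p"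
  have frame: "quad a11 a22 a12 a1 a2 c (s * p - t * q) (s * q + t * p) =
      l * s\<^sup>2 + 2 * \<alpha> * s + 2 * \<beta> * t + c" for s t
    unfolding quad_def a \<alpha>_def \<beta>_def using pq by algebra
  have "l * (l * (s0 + s)\<^sup>2 + 2 * \<alpha> * (s0 + s) + 2 * \<beta> * (t0 + t) + c) =
      l * (l * s\<^sup>2 + 2 * \<beta> * t)" for s t
    using s0 t0 by algebra
  then have vertex: "l * (s0 + s)\<^sup>2 + 2 * \<alpha> * (s0 + s) + 2 * \<beta> * (t0 + t) + c =
      l * s\<^sup>2 + 2 * \<beta> * t" for s t
    using l by (metis mult_left_cancel)
  have "quad a11 a22 a12 a1 a2 c (m1 + s * p - t * q) (m2 + s * q + t * p) =
      l * s\<^sup>2 + 2 * \<beta> * t" for s t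
    using frame[of "s0 + s" "t0 + t"] vertex[of s t] unfolding m1_def m2_def
    by (simp add: algebra_simps)
  then have S: "quad_locus a11 a22 a12 a1 a2 c =
      {(m1, m2) + s *\<^sub>R (p, q) + t *\<^sub>R (- q, p) | s t. l * s\<^sup>2 + 2 * \<beta> * t = 0}"
    by (rule quad_locus_in_frame[OF pq])
  define k where "k = - l / (2 * \<beta>)"
  have k: "k \<noteq> 0" using l \<beta> by (simp add: k_def)
  have S': "quad_locus a11 a22 a12 a1 a2 c =
      {(m1, m2) + s *\<^sub>R (p, q) + t *\<^sub>R (- q, p) | s t. t = k * s\<^sup>2}"
  proof -
    have "l * s\<^sup>2 + 2 * \<beta> * t = 0 \<longleftrightarrow> t = k * s\<^sup>2" for s t
      using \<beta> by (auto simp: k_def field_simps)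
    then show ?thesis unfolding S by simp
  qed
  have f: "orthonormal_frame (p, q) (- q, p)" using pq by (rule orthonormal_frame_rotation)
  show ?thesis
  proof (cases "k > 0")
    case True
    then show ?thesis unfolding is_parabola_def using f S' by blast
  next
    case False
    \<comment> \<open>The parabola opens towards \<open>-v\<close>, so that \<open>-v\<close> serves as the second frame vector.\<close>
    have "orthonormal_frame (p, q) (- (- q, p))"
      using f unfolding orthonormal_frame_def by (simp add: norm_Pair)
    moreover have "quad_locus a11 a22 a12 a1 a2 c =
        {(m1, m2) + s *\<^sub>R (p, q) + t *\<^sub>R (- (- q, p)) | s t. t = - k * s\<^sup>2}"
      unfolding S' by auto
    moreover have "- k > 0" using False k by simp
    ultimately show ?thesis unfolding is_parabola_def by blast
  qed
qed

text \<open>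
  Substituting the parametrization \<open>m + s u + k s\<^sup>2 v\<close> into the equation gives a polynomial in \<open>s\<close>
  of degree four that vanishes identically. Its two leading coefficients say that the quadratic
  form annihilates the pairs \<open>(v, v)\<close> and \<open>(u, v)\<close>; so \<open>v\<close> lies in the kernel of the form.
\<close>

lemma zero_if_is_parabola:
  fixes a11 a22 a12 a1 a2 c :: real
  assumes "is_parabola (quad_locus a11 a22 a12 a1 a2 c)"
  shows "a11 * a22 - a12\<^sup>2 = 0"
proof -
  obtain m u v k where f: "orthonormal_frame u v" and k: "k > 0"
    and S: "quad_locus a11 a22 a12 a1 a2 c = {m + s *\<^sub>R u + t *\<^sub>R v | s t. t = k * s\<^sup>2}"
    using assms unfolding is_parabola_def by blast
  obtain m1 m2 u1 u2 v1 v2 where mu: "m = (m1, m2)" "u = (u1, u2)" "v = (v1, v2)"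
    by (cases m, cases u, cases v)
  have on: "u1\<^sup>2 + u2\<^sup>2 = 1" "v1\<^sup>2 + v2\<^sup>2 = 1" "u1 * v1 + u2 * v2 = 0"
    using f unfolding orthonormal_frame_def mu by (simp_all add: norm_Pair)
  have z: "quad a11 a22 a12 a1 a2 c (m1 + s * u1 + k * s\<^sup>2 * v1) (m2 + s * u2 + k * s\<^sup>2 * v2) = 0"
    for s
  proof -
    have "m + s *\<^sub>R u + (k * s\<^sup>2) *\<^sub>R v \<in> quad_locus a11 a22 a12 a1 a2 c"
      unfolding S by blast
    then show ?thesis by (simp add: mu quad_locus_def)
  qed
  define e0 e1 e2 where "e0 = quad a11 a22 a12 a1 a2 c m1 m2"
    and "e1 = 2 * (a11 * m1 * u1 + a22 * m2 * u2 + a12 * (m1 * u2 + m2 * u1) + a1 * u1 + a2 * u2)"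
    and "e2 = a11 * u1\<^sup>2 + a22 * u2\<^sup>2 + 2 * a12 * u1 * u2 + 2 * k *
      (a11 * m1 * v1 + a22 * m2 * v2 + a12 * (m1 * v2 + m2 * v1) + a1 * v1 + a2 * v2)"
  define e3 e4 where "e3 = 2 * k * (a11 * u1 * v1 + a22 * u2 * v2 + a12 * (u1 * v2 + u2 * v1))"
    and "e4 = k\<^sup>2 * (a11 * v1\<^sup>2 + a22 * v2\<^sup>2 + 2 * a12 * v1 * v2)"
  have "e0 + e1 * s + e2 * s\<^sup>2 + e3 * s^3 + e4 * s^4 = 0" for s
    using z[of s] unfolding e0_def e1_def e2_def e3_def e4_def quad_def by algebra
  from this[of 0] this[of 1] this[of "-1"] this[of 2] this[of "-2"]
  have "e3 = 0" "e4 = 0" by simp_all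
  then have w: "a11 * u1 * v1 + a22 * u2 * v2 + a12 * (u1 * v2 + u2 * v1) = 0"
    "a11 * v1\<^sup>2 + a22 * v2\<^sup>2 + 2 * a12 * v1 * v2 = 0"
    using k by (simp_all add: e3_def e4_def)
  have "(a11 * v1 + a12 * v2) * u1 + (a12 * v1 + a22 * v2) * u2 = 0"
    "(a11 * v1 + a12 * v2) * v1 + (a12 * v1 + a22 * v2) * v2 = 0"
    using w by algebra+
  moreover have "(u1 * v2 - u2 * v1)\<^sup>2 = 1" using on by algebra
  ultimately have "a11 * v1 + a12 * v2 = 0" "a12 * v1 + a22 * v2 = 0" by algebra+
  then show ?thesis using on(2) by algebra
qed

lemma not_bounded_in_frame:
  fixes m u v :: "real \<times> real"
  assumes f: "orthonormal_frame u v"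
    and far: "\<And>r. \<exists>s t. s \<ge> r \<and> m + s *\<^sub>R u + t *\<^sub>R v \<in> S"
  shows "\<not> bounded S"
proof
  assume "bounded S"
  then obtain B where B: "\<And>z. z \<in> S \<Longrightarrow> norm z \<le> B" unfolding bounded_iff by blast
  obtain s t where s: "s \<ge> B + norm m + 1" and z: "m + s *\<^sub>R u + t *\<^sub>R v \<in> S" using far by blast
  have uu: "u \<bullet> u = 1" "v \<bullet> u = 0" "norm u = 1"
    using f unfolding orthonormal_frame_def by (simp_all add: dot_square_norm inner_commute)
  have "s = (m + s *\<^sub>R u + t *\<^sub>R v - m) \<bullet> u" using uu by (simp add: inner_add_left)
  also have "\<dots> \<le> norm (m + s *\<^sub>R u + t *\<^sub>R v - m)"
    using norm_cauchy_schwarz[of "m + s *\<^sub>R u + t *\<^sub>R v - m" u] uu by simp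
  also have "\<dots> \<le> B + norm m" using norm_triangle_ineq4[of "m + s *\<^sub>R u + t *\<^sub>R v" m] B[OF z] by linarith
  finally show False using s by simp
qed

lemma quad_locus_unbounded:
  assumes d: "a11 * a22 - a12\<^sup>2 \<le> 0" and D: "quad_det a11 a22 a12 a1 a2 c \<noteq> 0"
  shows "\<not> bounded (quad_locus a11 a22 a12 a1 a2 c)"
proof (cases "a11 * a22 - a12\<^sup>2 = 0")
  case True
  obtain m u v k where f: "orthonormal_frame u v"
    and S: "quad_locus a11 a22 a12 a1 a2 c = {m + s *\<^sub>R u + t *\<^sub>R v | s t. t = k * s\<^sup>2}"
    using is_parabola_if_zero[OF True D] unfolding is_parabola_def by blast
  show ?thesis by (rule not_bounded_in_frame[OF f, of m]) (auto simp: S)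
next
  case False
  obtain m u v l n k where f: "orthonormal_frame u v"
    and ln: "l * n = a11 * a22 - a12\<^sup>2" and "l + n = a11 + a22"
    and "l * n * k = quad_det a11 a22 a12 a1 a2 c"
    and S: "quad_locus a11 a22 a12 a1 a2 c =
      {m + s *\<^sub>R u + t *\<^sub>R v | s t. l * s\<^sup>2 + n * t\<^sup>2 + k = 0}"
    by (rule central_normal_form[OF False])
  have neg: "l * n < 0" using ln d False by simp
  then have n: "n \<noteq> 0" by auto
  define g where "g = - l / n"
  have g: "g > 0" using neg by (auto simp: g_def mult_less_0_iff divide_less_0_iff)
  show ?thesis
  proof (rule not_bounded_in_frame[OF f, of m])
    fix r :: real
    \<comment> \<open>The equation reads \<open>t\<^sup>2 = g s\<^sup>2 - k / n\<close>, and this \<open>s\<close> makes the right-hand side nonnegative.\<close>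
    define s where "s = max r (1 + \<bar>k / n\<bar> / g)"
    have s1: "s \<ge> 1 + \<bar>k / n\<bar> / g" by (simp add: s_def)
    moreover have "\<bar>k / n\<bar> / g \<ge> 0" using g by simp
    ultimately have "s \<ge> 1" by linarith
    then have "s \<le> s\<^sup>2" by (simp add: power2_eq_square)
    then have "\<bar>k / n\<bar> / g \<le> s\<^sup>2" using s1 by linarith
    then have "\<bar>k / n\<bar> \<le> g * s\<^sup>2" using g by (metis mult.commute pos_divide_le_eq)
    then have "(sqrt (g * s\<^sup>2 - k / n))\<^sup>2 = g * s\<^sup>2 - k / n" by (intro real_sqrt_pow2) linarith
    then have "l * s\<^sup>2 + n * (sqrt (g * s\<^sup>2 - k / n))\<^sup>2 + k = 0"
      using n by (simp add: g_def field_simps)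
    moreover have "s \<ge> r" by (simp add: s_def)
    ultimately show "\<exists>s t. s \<ge> r \<and> m + s *\<^sub>R u + t *\<^sub>R v \<in> quad_locus a11 a22 a12 a1 a2 c"
      unfolding S by blast
  qed
qed

text \<open>
  If the quadratic part is positive definite, the equation is \<open>l s\<^sup>2 + n t\<^sup>2 = -k\<close> with
  \<open>l, n > 0\<close>, and the sign of the determinant is that of \<open>k\<close>.
\<close>

lemma quad_locus_nonempty:
  assumes d: "a11 * a22 - a12\<^sup>2 > 0" and a11: "a11 > 0" and D: "quad_det a11 a22 a12 a1 a2 c < 0"
  shows "quad_locus a11 a22 a12 a1 a2 c \<noteq> {}"
proof -
  have nz: "a11 * a22 - a12\<^sup>2 \<noteq> 0" using d by simp
  obtain m u v l n k where "orthonormal_frame u v"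
    and ln: "l * n = a11 * a22 - a12\<^sup>2" and tr: "l + n = a11 + a22"
    and lnk: "l * n * k = quad_det a11 a22 a12 a1 a2 c"
    and S: "quad_locus a11 a22 a12 a1 a2 c =
      {m + s *\<^sub>R u + t *\<^sub>R v | s t. l * s\<^sup>2 + n * t\<^sup>2 + k = 0}"
    by (rule central_normal_form[OF nz])
  have "a11 * a22 > 0" using d zero_le_power2[of a12] by linarith
  then have "a22 > 0" using a11 by (simp add: zero_less_mult_iff)
  then have l: "l > 0" using ln d tr a11 by (smt (verit) zero_less_mult_iff)
  have "k < 0" using lnk D ln d by (metis mult_less_0_iff less_asym)
  then have "(sqrt (- k / l))\<^sup>2 = - k / l" using l by (intro real_sqrt_pow2 divide_nonneg_pos) simp_all
  then have "l * (sqrt (- k / l))\<^sup>2 + n * 0\<^sup>2 + k = 0" using l by simp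
  then show ?thesis unfolding S by blast
qed

section \<open>The anti-pedal as the dual conic\<close>

lemma antipedal_eq_quad_locus:
  "antipedal a11 a22 a12 a1 a2 c = quad_locus (a2\<^sup>2 - a22 * c) (a1\<^sup>2 - a11 * c)
     (a12 * c - a1 * a2) (a12 * a2 - a1 * a22) (a1 * a12 - a11 * a2) (a12\<^sup>2 - a11 * a22)"
  unfolding antipedal_def quad_locus_def quad_def by (simp add: algebra_simps)

lemma quad_det_antipedal:
  "quad_det (a2\<^sup>2 - a22 * c) (a1\<^sup>2 - a11 * c) (a12 * c - a1 * a2) (a12 * a2 - a1 * a22)
     (a1 * a12 - a11 * a2) (a12\<^sup>2 - a11 * a22) = - (quad_det a11 a22 a12 a1 a2 c)\<^sup>2"
  unfolding quad_det_def by algebra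

lemma quadratic_part_antipedal:
  "(a2\<^sup>2 - a22 * c) * (a1\<^sup>2 - a11 * c) - (a12 * c - a1 * a2)\<^sup>2 = c * quad_det a11 a22 a12 a1 a2 c"
  unfolding quad_det_def by algebra

text \<open>
  Completing the square in the homogenizing variable, \<open>c\<close> times the equation of \<open>C\<close> is
  \<open>(a1 x + a2 y + c)\<^sup>2\<close> plus a quadratic form with determinant \<open>c \<Delta> > 0\<close>. If the leading coefficient
  of the anti-pedal were not positive, this form would be positive definite, and \<open>C\<close> would have no real point.
\<close>

lemma antipedal_leading_coefficient_positive:
  fixes a11 a22 a12 a1 a2 c x y :: real
  assumes pos: "c * quad_det a11 a22 a12 a1 a2 c > 0" and z: "quad a11 a22 a12 a1 a2 c x y = 0"
  shows "a2\<^sup>2 - a22 * c > 0"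
proof (rule ccontr)
  assume neg: "\<not> ?thesis"
  define e f g where "e = a22 * c - a2\<^sup>2" and "f = a11 * c - a1\<^sup>2" and "g = a12 * c - a1 * a2"
  have d: "e * f - g\<^sup>2 > 0"
    using pos quadratic_part_antipedal[of a2 a22 c a1 a11 a12] unfolding e_def f_def g_def
    by (simp add: algebra_simps)
  have "e \<noteq> 0" using d by auto
  then have e: "e > 0" using neg by (simp add: e_def)
  have "e * (c * quad a11 a22 a12 a1 a2 c x y) =
      e * (a1 * x + a2 * y + c)\<^sup>2 + (e * y + g * x)\<^sup>2 + (e * f - g\<^sup>2) * x\<^sup>2"
    unfolding e_def f_def g_def quad_def by algebra
  then have sum: "e * (a1 * x + a2 * y + c)\<^sup>2 + (e * y + g * x)\<^sup>2 + (e * f - g\<^sup>2) * x\<^sup>2 = 0"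
    using z by simp
  have nn: "e * (a1 * x + a2 * y + c)\<^sup>2 \<ge> 0" "(e * y + g * x)\<^sup>2 \<ge> 0" "(e * f - g\<^sup>2) * x\<^sup>2 \<ge> 0"
    using e d by simp_all
  have "(e * f - g\<^sup>2) * x\<^sup>2 = 0" "(e * y + g * x)\<^sup>2 = 0" "e * (a1 * x + a2 * y + c)\<^sup>2 = 0"
    using sum nn by linarith+
  then have "x = 0" "y = 0" "c = 0" using d e by auto
  then show False using pos by simp
qed

lemma inversion_antipedal_in_pedal:
  assumes z: "(x, y) \<in> antipedal a11 a22 a12 a1 a2 c" and nz: "x\<^sup>2 + y\<^sup>2 \<noteq> 0"
  shows "(x / (x\<^sup>2 + y\<^sup>2), y / (x\<^sup>2 + y\<^sup>2)) \<in> pedal a11 a22 a12 a1 a2 c"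
proof -
  define w where "w = inverse (x\<^sup>2 + y\<^sup>2)"
  have w: "w * (x\<^sup>2 + y\<^sup>2) = 1" using nz by (simp add: w_def)
  have "(x * w, y * w) \<in> pedal a11 a22 a12 a1 a2 c"
  proof -
    have r: "(x * w)\<^sup>2 + (y * w)\<^sup>2 = w" using w by algebra
    have "(a2\<^sup>2 - a22 * c) * x\<^sup>2 + (a1\<^sup>2 - a11 * c) * y\<^sup>2 + 2 * (a12 * c - a1 * a2) * x * y
        + 2 * (a12 * a2 - a1 * a22) * x + 2 * (a1 * a12 - a11 * a2) * y + a12\<^sup>2 - a11 * a22 = 0"
      using z by (simp add: antipedal_def)
    then show ?thesis unfolding pedal_def mem_Collect_eq prod.case r by algebra
  qed
  then show ?thesis by (simp add: w_def divide_inverse)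
qed

lemma antipedal_bounded:
  assumes "(0, 0) isolated_in pedal a11 a22 a12 a1 a2 c"
  shows "bounded (antipedal a11 a22 a12 a1 a2 c)"
proof -
  obtain T where T: "open T" "T \<inter> pedal a11 a22 a12 a1 a2 c = {(0, 0)}"
    using assms unfolding isolated_in_def by blast
  then obtain e where e: "e > 0" "ball (0, 0) e \<subseteq> T"
    by (metis Int_iff insertI1 open_contains_ball)
  have "norm z \<le> 1 / e" if "z \<in> antipedal a11 a22 a12 a1 a2 c" for z
  proof (rule ccontr)
    assume far: "\<not> norm z \<le> 1 / e"
    obtain x y where xy: "z = (x, y)" by (cases z)
    have n2: "x\<^sup>2 + y\<^sup>2 = (norm z)\<^sup>2" by (simp add: xy norm_Pair)
    have n: "norm z > 0" using far e(1) by (smt (verit) divide_pos_pos)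
    define w where "w = (x / (x\<^sup>2 + y\<^sup>2), y / (x\<^sup>2 + y\<^sup>2))"
    have w: "w = (1 / (norm z)\<^sup>2) *\<^sub>R z" unfolding w_def n2 by (simp add: xy)
    then have nw: "norm w = 1 / norm z" using n by (simp add: power2_eq_square)
    have "1 / norm z < e" using far e(1) n by (simp add: field_simps)
    then have "w \<in> ball 0 e" using nw by simp
    then have "w \<in> T" using e(2) by (auto simp: zero_prod_def)
    moreover have "w \<in> pedal a11 a22 a12 a1 a2 c"
      unfolding w_def
    proof (rule inversion_antipedal_in_pedal)
      show "(x, y) \<in> antipedal a11 a22 a12 a1 a2 c" using that xy by simp
      show "x\<^sup>2 + y\<^sup>2 \<noteq> 0" using n n2 by simp
    qed
    ultimately have "w = (0, 0)" using T(2) by blast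
    then show False using nw n by (simp add: zero_prod_def[symmetric])
  qed
  then show ?thesis unfolding bounded_iff by blast
qed

theorem proposition3p4:
  fixes a11 a22 a12 a1 a2 c :: real and C :: "(real \<times> real) set"
  assumes "C = quad_locus a11 a22 a12 a1 a2 c"
    and "irreducible_quad a11 a22 a12 a1 a2 c"
    and "C \<noteq> {}"
  shows "irreducible_quadratic_curve (antipedal a11 a22 a12 a1 a2 c)
    \<and> ((0, 0) isolated_in pedal a11 a22 a12 a1 a2 c \<longrightarrow> is_ellipse (antipedal a11 a22 a12 a1 a2 c))
    \<and> (is_parabola (antipedal a11 a22 a12 a1 a2 c) \<longleftrightarrow> (0, 0) \<in> C)"
proof -
  define D where "D = quad_det a11 a22 a12 a1 a2 c"
  have D: "D \<noteq> 0" using assms(2) by (simp add: D_def irreducible_quad_iff_quad_det)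
  obtain x y where z: "quad a11 a22 a12 a1 a2 c x y = 0"
    using assms(1,3) by (auto simp: quad_locus_def)
  define b11 b22 b12 where "b11 = a2\<^sup>2 - a22 * c" and "b22 = a1\<^sup>2 - a11 * c"
    and "b12 = a12 * c - a1 * a2"
  define b1 b2 b0 where "b1 = a12 * a2 - a1 * a22" and "b2 = a1 * a12 - a11 * a2"
    and "b0 = a12\<^sup>2 - a11 * a22"
  note b = b11_def b22_def b12_def b1_def b2_def b0_def
  have S: "antipedal a11 a22 a12 a1 a2 c = quad_locus b11 b22 b12 b1 b2 b0"
    unfolding b by (rule antipedal_eq_quad_locus)
  have det: "quad_det b11 b22 b12 b1 b2 b0 = - D\<^sup>2"
    unfolding b D_def by (rule quad_det_antipedal)
  have disc: "b11 * b22 - b12\<^sup>2 = c * D"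
    unfolding b D_def by (rule quadratic_part_antipedal)
  have det_nz: "quad_det b11 b22 b12 b1 b2 b0 \<noteq> 0" using det D by simp
  have ne: "quad_locus b11 b22 b12 b1 b2 b0 \<noteq> {}"
  proof (cases "c * D > 0")
    case True
    then have "b11 > 0" using antipedal_leading_coefficient_positive z unfolding b D_def by blast
    moreover have "quad_det b11 b22 b12 b1 b2 b0 < 0" using det D by simp
    ultimately show ?thesis using quad_locus_nonempty disc True by simp
  next
    case False
    then show ?thesis using quad_locus_unbounded[OF _ det_nz] disc by force
  qed
  have "irreducible_quadratic_curve (antipedal a11 a22 a12 a1 a2 c)"
    unfolding irreducible_quadratic_curve_def S
    using ne det_nz irreducible_quad_iff_quad_det by blast
  moreover have "is_ellipse (antipedal a11 a22 a12 a1 a2 c)"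
    if "(0, 0) isolated_in pedal a11 a22 a12 a1 a2 c"
  proof -
    have "bounded (quad_locus b11 b22 b12 b1 b2 b0)" using antipedal_bounded[OF that] S by simp
    then have "b11 * b22 - b12\<^sup>2 > 0" using quad_locus_unbounded[OF _ det_nz] by force
    then show ?thesis unfolding S using is_ellipse_if_pos det_nz ne by blast
  qed
  moreover have "is_parabola (antipedal a11 a22 a12 a1 a2 c) \<longleftrightarrow> (0, 0) \<in> C"
  proof -
    have "is_parabola (antipedal a11 a22 a12 a1 a2 c) \<longleftrightarrow> b11 * b22 - b12\<^sup>2 = 0"
      unfolding S using zero_if_is_parabola is_parabola_if_zero[OF _ det_nz] by blast
    also have "\<dots> \<longleftrightarrow> c = 0" using disc D by simp
    also have "\<dots> \<longleftrightarrow> (0, 0) \<in> C" by (simp add: assms(1) quad_locus_def quad_def)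
    finally show ?thesis .
  qed
  ultimately show ?thesis by blast
qed

end
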